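(* Let $n,m\ge 1$, let $A\in\mathbb{R}^{n\times n}$, $B\in\mathbb{R}^{n\times m}$, let $h>0$, $\alpha\ge 0$ and $\varepsilon_1,\varepsilon_2,\varepsilon_3,\varepsilon_4\in\mathbb{R}$. Assume that there exist matrices $P\in\mathbb{S}^{2n}_+$, $R,S\in\mathbb{S}^n_+$, an invertible matrix $X\in\mathbb{R}^{n\times n}$, a matrix $\bar K\in\mathbb{R}^{m\times n}$ and a real number $\beta_1>0$ such that $$P+\frac{e^{-2\alpha h}}{h}\,\mathrm{diag}(0_n,S)+\frac{4\alpha^2h}{e^{2\alpha h}-2h\alpha-1}\begin{bmatrix} h^2R & -hR \\ -hR & R \end{bmatrix}-\beta_1\,\mathrm{diag}(I_n,0_n)\succ 0$$ and $$\Phi(\alpha,h)+\mathrm{He}\left(\left(N\tilde X+\begin{bmatrix} 0_n & 0_n & 0_n & B\bar K \end{bmatrix}\right)^{\top}F_\varepsilon\right)\prec 0,$$ where $$N=\begin{bmatrix} A & 0_n & -I_n & 0_n \end{bmatrix},\quad \tilde X=\mathrm{diag}(X,X,X,X),\quad F_\varepsilon=\begin{bmatrix} \varepsilon_1I_n & \varepsilon_2I_n & \varepsilon_3I_n & \varepsilon_4I_n \end{bmatrix},$$ and $\Phi(\alpha,h)$ is the matrix (depending on $P,R,S$) defined in the context. Then, with the feedback gain $K=\bar KX^{-1}$, the time-delay system $$\dot x(t)=Ax(t)+\frac1h BK\int_{t-h}^{t}x(s)\,ds\quad(t\ge0),\qquad x(t)=\phi(t)\quad(t\in[-h,0]),$$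 is $\alpha$-stable.
   Context: $\mathbb{S}^m$ is the set of real symmetric $m\times m$ matrices; $\mathbb{S}^m_+$ is the set of symmetric positive definite ones; $M\succ0$ (resp. $M\prec 0$) means $M$ is symmetric positive (resp. negative) definite. $I_n$ is the $n\times n$ identity, $0_n$ (resp. $0_{2n}$) the zero matrix of size $n\times n$ (resp. $2n\times 2n$). $\mathrm{He}(M)=M+M^{\top}$, and $\mathrm{diag}(\cdot)$ denotes the block-diagonal matrix. $\|\cdot\|$ is the Euclidean norm on $\mathbb{R}^n$. Given $P\in\mathbb{S}^{2n}$, $R,S\in\mathbb{S}^n_+$, $h>0$, $\alpha\ge0$: $$\Phi(\alpha,h)=\mathrm{He}\left(F_1^{\top}P(F_0+\alpha F_1)\right)+\bar S+h^2F_3^{\top}RF_3-e^{-2\alpha h}F_2^{\top}\tilde RF_2,$$ $$F_0=\begin{bmatrix} 0_n & 0_n & I_n & 0_n \\ I_n & -I_n & 0_n & 0_n \end{bmatrix},\quad F_1=\begin{bmatrix} I_n & 0_n & 0_n & 0_n \\ 0_n & 0_n & 0_n & hI_n \end{bmatrix},\quad F_2=\begin{bmatrix} I_n & -I_n & 0_n & 0_n \\ I_n & I_n & 0_n & -2I_n \end{bmatrix},$$ $$F_3=\begin{bmatrix} 0_n & 0_n & I_n & 0_n \end{bmatrix},\quad \tilde R=\mathrm{diag}(R,3R),\quad \bar S=\mathrm{diag}(S,-e^{-2\alpha h}S,0_{2n}).$$ For a differentiable function $\phi:[-h,0]\to\mathbb{R}^n$: $\|\phi\|_h=\sup_{\theta\in[-h,0]}\|\phi(\theta)\|$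 and $\|\phi\|_W=\max\{\|\phi\|_h,\|\dot\phi\|_h\}$. A time-delay system is called $\alpha$-stable if there exists $\gamma\ge1$ such that every solution $x$ with a differentiable initial condition $\phi$ on $[-h,0]$ satisfies $\|x(t)\|\le\gamma e^{-\alpha t}\|\phi\|_W$ for all $t>0$. For $\alpha=0$, the coefficient $\frac{4\alpha^2h}{e^{2\alpha h}-2h\alpha-1}$ is understood as its limit as $\alpha\to0$, namely $2/h$. *)

theory Defs
  imports "HOL-Analysis.Analysis"
begin

text \<open>
  Block matrices are indexed by sum types: a matrix with 2n columns has column index
  type \<open>'n + 'n\<close>, one with 4n columns has \<open>'n + 'n + 'n + 'n\<close> (right-nested).
  \<open>M ||| N\<close> is juxtaposition of columns, \<open>M === N\<close> is stacking of rows.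
\<close>

definition hcat :: "'a^'k^'r \<Rightarrow> 'a^'l^'r \<Rightarrow> 'a^('k + 'l)^'r"  (infixr "|||" 67) where
  "M ||| N = (\<chi> i j. case j of Inl a \<Rightarrow> M $ i $ a | Inr b \<Rightarrow> N $ i $ b)"

definition vcat :: "'a^'c^'k \<Rightarrow> 'a^'c^'l \<Rightarrow> 'a^'c^('k + 'l)"  (infixr "===" 66) where
  "M === N = (\<chi> i. case i of Inl a \<Rightarrow> M $ a | Inr b \<Rightarrow> N $ b)"

definition bdiag :: "real^'k^'r \<Rightarrow> real^'l^'s \<Rightarrow> real^('k + 'l)^('r + 's)" where
  "bdiag M N = (M ||| 0) === (0 ||| N)"

definition He :: "real^'k^'k \<Rightarrow> real^'k^'k" where
  "He M = M + transpose M"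

definition pos_def :: "real^'k^'k \<Rightarrow> bool" where
  "pos_def M \<longleftrightarrow> transpose M = M \<and> (\<forall>v. v \<noteq> 0 \<longrightarrow> v \<bullet> (M *v v) > 0)"

definition neg_def :: "real^'k^'k \<Rightarrow> bool" where
  "neg_def M \<longleftrightarrow> transpose M = M \<and> (\<forall>v. v \<noteq> 0 \<longrightarrow> v \<bullet> (M *v v) < 0)"

definition F0 :: "real^('n::finite + 'n + 'n + 'n)^('n + 'n)" where
  "F0 = (0     ||| 0       ||| mat 1 ||| 0)
    === (mat 1 ||| - mat 1 ||| 0     ||| 0)"

definition F1 :: "real \<Rightarrow> real^('n::finite + 'n + 'n + 'n)^('n + 'n)" where
  "F1 h = (mat 1 ||| 0 ||| 0 ||| 0)
      === (0     ||| 0 ||| 0 ||| h *\<^sub>R mat 1)"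

definition F2 :: "real^('n::finite + 'n + 'n + 'n)^('n + 'n)" where
  "F2 = (mat 1 ||| - mat 1 ||| 0 ||| 0)
    === (mat 1 ||| mat 1   ||| 0 ||| - (2 *\<^sub>R mat 1))"

definition F3 :: "real^('n::finite + 'n + 'n + 'n)^'n" where
  "F3 = 0 ||| 0 ||| mat 1 ||| 0"

definition R_tilde :: "real^'n^'n \<Rightarrow> real^('n + 'n)^('n + 'n)" where
  "R_tilde R = bdiag R (3 *\<^sub>R R)"

definition S_bar :: "real \<Rightarrow> real \<Rightarrow> real^'n^'n \<Rightarrow> real^('n + 'n + 'n + 'n)^('n + 'n + 'n + 'n)" where
  "S_bar \<alpha> h S = bdiag S (bdiag (- (exp (- 2 * \<alpha> * h) *\<^sub>R S)) (0 :: real^('n + 'n)^('n + 'n)))"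

definition Phi :: "real^('n::finite + 'n)^('n + 'n) \<Rightarrow> real^'n^'n \<Rightarrow> real^'n^'n \<Rightarrow> real \<Rightarrow> real
    \<Rightarrow> real^('n + 'n + 'n + 'n)^('n + 'n + 'n + 'n)" where
  "Phi P R S \<alpha> h =
     He (transpose (F1 h) ** P ** (F0 + \<alpha> *\<^sub>R F1 h))
     + S_bar \<alpha> h S
     + h\<^sup>2 *\<^sub>R (transpose F3 ** R ** F3)
     - exp (- 2 * \<alpha> * h) *\<^sub>R (transpose F2 ** R_tilde R ** F2)"

text \<open>The value \<open>2 / h\<close> is the limit of the quotient as \<open>\<alpha>\<close> tends to 0.\<close>

definition R_coeff :: "real \<Rightarrow> real \<Rightarrow> real" where
  "R_coeff \<alpha> h =
     (if \<alpha> = 0 then 2 / h else 4 * \<alpha>\<^sup>2 * h / (exp (2 * \<alpha> * h) - 2 * h * \<alpha> - 1))"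

text \<open>
  The norms take values in the extended reals: the derivative of a differentiable function
  on a compact interval may be unbounded, and then its supremum norm is infinite.
\<close>

definition norm_h :: "real \<Rightarrow> (real \<Rightarrow> real^'n) \<Rightarrow> ereal" where
  "norm_h h \<phi> = (SUP \<theta>\<in>{- h..0}. ereal (norm (\<phi> \<theta>)))"

definition norm_W :: "real \<Rightarrow> (real \<Rightarrow> real^'n) \<Rightarrow> ereal" where
  "norm_W h \<phi> =
     max (norm_h h \<phi>) (norm_h h (\<lambda>\<theta>. vector_derivative \<phi> (at \<theta> within {- h..0})))"

text \<open>
  A time-delay system with delay \<open>h\<close> is given by its right-hand side \<open>G\<close>: the equation is
  \<open>x'(t) = G x t\<close> for \<open>t \<ge> 0\<close>, with the derivative at \<open>t = 0\<close> taken from the right.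
\<close>

definition delay_solution ::
  "real \<Rightarrow> ((real \<Rightarrow> real^'n) \<Rightarrow> real \<Rightarrow> real^'n) \<Rightarrow> (real \<Rightarrow> real^'n) \<Rightarrow> (real \<Rightarrow> real^'n) \<Rightarrow> bool" where
  "delay_solution h G \<phi> x \<longleftrightarrow>
     (\<forall>t\<in>{- h..0}. x t = \<phi> t) \<and>
     (\<forall>t\<ge>0. (x has_vector_derivative G x t) (at t within {0..}))"

definition alpha_stable :: "real \<Rightarrow> real \<Rightarrow> ((real \<Rightarrow> real^'n) \<Rightarrow> real \<Rightarrow> real^'n) \<Rightarrow> bool" where
  "alpha_stable \<alpha> h G \<longleftrightarrow>
     (\<exists>\<gamma>\<ge>1. \<forall>\<phi> x. \<phi> differentiable_on {- h..0} \<longrightarrow> delay_solution h G \<phi> x \<longrightarrow>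
        (\<forall>t>0. ereal (norm (x t)) \<le> ereal (\<gamma> * exp (- \<alpha> * t)) * norm_W h \<phi>))"

end

theory Submission
  imports Defs
begin

text \<open>In the coordinates \<open>y = X\<inverse> x\<close>, the vector of \<open>y(t)\<close>, \<open>y(t - h)\<close>, \<open>y'(t)\<close> and the mean of \<open>y\<close>
  over \<open>[t - h, t]\<close> is annihilated by the matrix \<open>N X~ + [0 0 0 B Kbar]\<close>, so on it the second matrix
  inequality reduces to nonpositivity of the quadratic form of \<open>\<Phi>\<close>. By the Wirtinger-based integral
  inequality this form dominates the derivative of a Lyapunov-Krasovskii functional weighted by
  \<open>exp (2 \<alpha> t)\<close>, which is therefore nonincreasing and, as \<open>P\<close> is positive definite, controls
  \<open>exp (2 \<alpha> t) \<parallel>y(t)\<parallel>\<^sup>2\<close>. The functional is used only for \<open>t \<ge> h\<close>, where its integrals involve no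
  derivative of the initial condition (which need not be integrable); on \<open>[0, h]\<close> a Gronwall-type
  estimate bounds \<open>x\<close> and \<open>x'\<close> by the initial condition.\<close>

section \<open>Block vectors and block matrices\<close>

definition vjoin :: "'a^'k \<Rightarrow> 'a^'l \<Rightarrow> 'a^('k + 'l)" where
  "vjoin u v = (\<chi> i. case i of Inl a \<Rightarrow> u $ a | Inr b \<Rightarrow> v $ b)"

definition quad_form :: "real^'k^'k \<Rightarrow> real^'k \<Rightarrow> real" where
  "quad_form M v = v \<bullet> (M *v v)"

lemma sum_UNIV_Plus:
  fixes f :: "'k::finite + 'l::finite \<Rightarrow> 'b::comm_monoid_add"
  shows "sum f UNIV = (\<Sum>a\<in>UNIV. f (Inl a)) + (\<Sum>b\<in>UNIV. f (Inr b))"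
  unfolding UNIV_Plus_UNIV [symmetric] by (subst sum.Plus) simp_all

text \<open>Splitting the sum over a sum type separates the blocks. With
  \<open>vcat_mult_vec\<close> and \<open>bdiag_mult_vjoin\<close>, this lets block products be
  evaluated by rewriting alone.\<close>

lemma hcat_mult_vjoin: "(M ||| N) *v vjoin u v = M *v u + N *v v"
  by (simp add: vec_eq_iff matrix_vector_mult_def hcat_def vjoin_def sum_UNIV_Plus)

lemma vcat_mult_vec: "(M === N) *v w = vjoin (M *v w) (N *v w)"
  by (simp add: vec_eq_iff matrix_vector_mult_def vcat_def vjoin_def split: sum.split)

lemma bdiag_mult_vjoin: "bdiag M N *v vjoin u v = vjoin (M *v u) (N *v v)"
  by (simp add: bdiag_def vcat_mult_vec hcat_mult_vjoin)

lemma inner_vjoin: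
  fixes u u' :: "real^'k" and v v' :: "real^'l"
  shows "vjoin u v \<bullet> vjoin u' v' = u \<bullet> u' + v \<bullet> v'"
  by (simp add: inner_vec_def vjoin_def sum_UNIV_Plus)

lemma vjoin_add: "vjoin (u + u') (v + v') = vjoin u v + vjoin u' v'"
  by (simp add: vec_eq_iff vjoin_def split: sum.split)

lemma vjoin_scaleR: "vjoin (c *\<^sub>R u) (c *\<^sub>R v) = c *\<^sub>R vjoin u v"
  by (simp add: vec_eq_iff vjoin_def split: sum.split)

text \<open>Stacking is viewed as a map on pairs so that derivatives and continuity of stacked
  functions follow from those of their components.\<close>

lemma bounded_linear_vjoin:
  "bounded_linear (\<lambda>p :: (real^'k) \<times> (real^'l). vjoin (fst p) (snd p))"
  unfolding linear_conv_bounded_linear [symmetric]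
  by (rule linearI) (simp_all add: vjoin_add vjoin_scaleR)

lemma has_vector_derivative_vjoin:
  fixes f :: "real \<Rightarrow> real^'k" and g :: "real \<Rightarrow> real^'l"
  assumes "(f has_vector_derivative f') (at t within T)"
    "(g has_vector_derivative g') (at t within T)"
  shows "((\<lambda>t. vjoin (f t) (g t)) has_vector_derivative vjoin f' g') (at t within T)"
  using bounded_linear.has_vector_derivative
      [OF bounded_linear_vjoin has_vector_derivative_Pair [OF assms]]
  by simp

lemma continuous_on_vjoin:
  fixes f :: "real \<Rightarrow> real^'k" and g :: "real \<Rightarrow> real^'l"
  assumes "continuous_on T f" "continuous_on T g"
  shows "continuous_on T (\<lambda>t. vjoin (f t) (g t))"
  using bounded_linear.continuous_on [OF bounded_linear_vjoin continuous_on_Pair [OF assms]]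
  by simp

section \<open>Quadratic forms\<close>

lemma inner_symmetric_matrix:
  fixes M :: "real^'k^'k"
  assumes "transpose M = M"
  shows "u \<bullet> (M *v v) = v \<bullet> (M *v u)"
  using dot_lmul_matrix [of u M v] transpose_matrix_vector [of M u]
  unfolding assms inner_commute [of v] by simp

lemma inner_vector_matrix_mult:
  fixes M :: "real^'k^'l"
  shows "u \<bullet> (v v* M) = (M *v u) \<bullet> v"
  using dot_lmul_matrix [of v M u] unfolding inner_commute [of u] inner_commute [of "M *v u"] .

lemma quad_form_He: "quad_form (He M) v = 2 * (v \<bullet> (M *v v))"
  unfolding quad_form_def He_def matrix_vector_mult_add_rdistrib inner_add_right
    transpose_matrix_vector inner_vector_matrix_mult inner_commute [of "M *v v"] by simp

lemma matrix_mult_matrix_inv: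
  assumes "invertible A"
  shows "A ** matrix_inv A = mat 1"
  using assms unfolding invertible_def matrix_inv_def by (rule someI2_ex) blast

lemma quad_form_add: "quad_form (M + N) v = quad_form M v + quad_form N v"
  by (simp add: quad_form_def matrix_vector_mult_add_rdistrib inner_add_right)

lemma quad_form_diff: "quad_form (M - N) v = quad_form M v - quad_form N v"
  by (simp add: quad_form_def matrix_vector_mult_diff_rdistrib inner_diff_right)

lemma scaleR_matrix_mult_vec: "(c *\<^sub>R M) *v (v::real^'k) = c *\<^sub>R (M *v v)"
  by (simp add: vec_eq_iff matrix_vector_mult_def sum_distrib_left mult.assoc)

lemma uminus_matrix_mult_vec: "(- M) *v (v::real^'k) = - (M *v v)"
  by (simp add: vec_eq_iff matrix_vector_mult_def sum_negf)

lemma quad_form_scaleR: "quad_form (c *\<^sub>R M) v = c * quad_form M v"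
  by (simp add: quad_form_def scaleR_matrix_mult_vec)

lemma quad_form_uminus: "quad_form (- M) v = - quad_form M v"
  by (simp add: quad_form_def uminus_matrix_mult_vec)

lemma quad_form_0: "quad_form 0 v = 0"
  by (simp add: quad_form_def)

lemma quad_form_bdiag: "quad_form (bdiag M N) (vjoin u v) = quad_form M u + quad_form N v"
  unfolding quad_form_def bdiag_mult_vjoin inner_vjoin by (rule refl)

lemma quad_form_conj: "quad_form (transpose F ** M ** F) v = quad_form M (F *v v)"
  unfolding quad_form_def matrix_vector_mul_assoc [symmetric] transpose_matrix_vector
    inner_vector_matrix_mult by (rule refl)

text \<open>For \<open>y\<close>, \<open>z\<close>, \<open>d\<close>, \<open>w\<close> standing for
  the present value, the delayed value, the derivative and the mean over the delay window,
  \<open>F1\<close> produces the argument of \<open>P\<close>, \<open>F0\<close> its time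
  derivative, and \<open>F2\<close> the two vectors of the Wirtinger-based inequality.\<close>

lemma quad_form_Phi:
  fixes y z d w :: "real^'n"
  shows "quad_form (Phi P R S \<alpha> h) (vjoin y (vjoin z (vjoin d w))) =
    2 * (vjoin y (h *\<^sub>R w) \<bullet> (P *v (vjoin d (y - z) + \<alpha> *\<^sub>R vjoin y (h *\<^sub>R w))))
    + quad_form S y - exp (- 2 * \<alpha> * h) * quad_form S z + h\<^sup>2 * quad_form R d
    - exp (- 2 * \<alpha> * h) * (quad_form R (y - z) + 3 * quad_form R (y + z - 2 *\<^sub>R w))"
proof -
  let ?v = "vjoin y (vjoin z (vjoin d w))"
  have F: "F0 *v ?v = vjoin d (y - z)" "F1 h *v ?v = vjoin y (h *\<^sub>R w)"
    "F2 *v ?v = vjoin (y - z) (y + z - 2 *\<^sub>R w)" "F3 *v ?v = d"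
    by (simp_all add: F0_def F1_def F2_def F3_def vcat_mult_vec hcat_mult_vjoin
        uminus_matrix_mult_vec scaleR_matrix_mult_vec add_diff_eq)
  show ?thesis
    unfolding Phi_def quad_form_diff quad_form_add quad_form_He quad_form_scaleR quad_form_conj F
      S_bar_def R_tilde_def quad_form_bdiag quad_form_uminus quad_form_0
    unfolding matrix_vector_mul_assoc [symmetric] transpose_matrix_vector
      inner_vector_matrix_mult F matrix_vector_mult_add_rdistrib scaleR_matrix_mult_vec
    by simp
qed

text \<open>The form is twice the inner product of \<open>M *v v\<close> and \<open>N *v v\<close>.
  Hence the slack term of the second matrix inequality vanishes on the kernel of its left factor,
  whatever the scalars in its right factor.\<close>

lemma quad_form_He_eq_0:
  assumes "M *v v = 0"
  shows "quad_form (He (transpose M ** N)) v = 0"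
  unfolding quad_form_He matrix_vector_mul_assoc [symmetric] transpose_matrix_vector
    inner_vector_matrix_mult assms by simp

text \<open>By compactness the form attains a minimum on the unit sphere; it is positive, and
  homogeneity of degree two extends the bound to all vectors.\<close>

lemma pos_def_coercive:
  assumes "pos_def (M::real^'k^'k)"
  shows "\<exists>c>0. \<forall>v. c * (norm v)\<^sup>2 \<le> quad_form M v"
proof -
  let ?S = "sphere (0::real^'k) 1"
  have "continuous_on ?S (quad_form M)"
    unfolding quad_form_def by (intro continuous_intros)
  moreover have "?S \<noteq> {}" by simp
  ultimately obtain u where u: "u \<in> ?S" "\<And>v. v \<in> ?S \<Longrightarrow> quad_form M u \<le> quad_form M v"
    using continuous_attains_inf [of ?S "quad_form M"] by auto
  have "u \<noteq> 0" using u(1) by auto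
  then have "quad_form M u > 0" using assms by (auto simp: pos_def_def quad_form_def)
  moreover have "quad_form M u * (norm v)\<^sup>2 \<le> quad_form M v" for v
  proof (cases "v = 0")
    case False
    have "quad_form M u \<le> quad_form M (v /\<^sub>R norm v)"
      using False by (intro u(2)) simp
    also have "\<dots> = quad_form M v / (norm v)\<^sup>2"
      by (simp add: quad_form_def matrix_vector_mult_scaleR power2_eq_square field_simps)
    finally show ?thesis using False by (simp add: field_simps)
  qed (simp add: quad_form_def)
  ultimately show ?thesis by blast
qed

lemma quad_form_le:
  fixes M :: "real^'k^'k"
  shows "\<exists>c>0. \<forall>v. quad_form M v \<le> c * (norm v)\<^sup>2"
proof -
  have "bounded_linear ((*v) M)" by simp
  then obtain c where c: "c > 0" "\<And>v. norm (M *v v) \<le> norm v * c"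
    using bounded_linear.pos_bounded by blast
  have "quad_form M v \<le> c * (norm v)\<^sup>2" for v
  proof -
    have "quad_form M v \<le> norm v * norm (M *v v)"
      unfolding quad_form_def by (rule norm_cauchy_schwarz)
    also have "\<dots> \<le> norm v * (norm v * c)" by (intro mult_left_mono c) simp
    finally show ?thesis by (simp add: power2_eq_square algebra_simps)
  qed
  with c(1) show ?thesis by blast
qed

text \<open>Symmetry makes the two terms of the product rule coincide.\<close>

lemma has_real_derivative_quad_form:
  fixes f :: "real \<Rightarrow> real^'k"
  assumes "transpose M = M" "(f has_vector_derivative f') (at t)"
  shows "((\<lambda>t. quad_form M (f t)) has_real_derivative 2 * (f t \<bullet> (M *v f'))) (at t)"
proof -
  have "((\<lambda>t. M *v f t) has_vector_derivative M *v f') (at t)"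
    using assms(2) by (rule bounded_linear.has_vector_derivative [rotated]) simp
  then have "((\<lambda>t. f t \<bullet> (M *v f t)) has_vector_derivative (f t \<bullet> (M *v f') + f' \<bullet> (M *v f t))) (at t)"
    by (rule bounded_bilinear.has_vector_derivative [OF bounded_bilinear_inner assms(2)])
  then show ?thesis
    using inner_symmetric_matrix [OF assms(1), of f' "f t"]
    by (simp add: quad_form_def has_real_derivative_iff_has_vector_derivative)
qed

lemma continuous_on_quad_form [continuous_intros]:
  "continuous_on T f \<Longrightarrow> continuous_on T (\<lambda>t. quad_form M (f t))"
  unfolding quad_form_def
  by (intro continuous_intros bounded_linear.continuous_on [of "(*v) M"]) simp_all

section \<open>Antiderivatives and increments on a half-line\<close>

lemma antiderivative_Ici:
  fixes f :: "real \<Rightarrow> 'a::banach"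
  assumes "continuous_on {a..} f"
  shows "\<exists>F. \<forall>t\<ge>a. (F has_vector_derivative f t) (at t within {a..})"
proof (intro exI allI impI)
  fix t :: real assume t: "t \<ge> a"
  have "continuous_on {a..t + 1} f"
    using assms by (rule continuous_on_subset) auto
  then have "((\<lambda>u. integral {a..u} f) has_vector_derivative f t) (at t within {a..t + 1})"
    using t by (intro integral_has_vector_derivative) auto
  \<comment> \<open>The right end \<open>t + 1\<close> lies beyond \<open>t\<close>, so the bounded
    interval and the half-line agree near \<open>t\<close>, also when \<open>t = a\<close>.\<close>
  moreover have "at t within {a..t + 1} = at t within {a..}"
    by (rule at_within_nhd [of _ "{..<t + 1}"]) auto
  ultimately show "((\<lambda>u. integral {a..u} f) has_vector_derivative f t) (at t within {a..})"
    by simp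
qed

lemma has_vector_derivative_at_interior_Ici:
  fixes t a :: real
  assumes "(f has_vector_derivative f') (at t within {a..})" "t > a"
  shows "(f has_vector_derivative f') (at t)"
proof -
  have "at t within {a..} = at t"
    using assms(2) by (intro at_within_interior) (simp add: interior_real_atLeast)
  with assms(1) show ?thesis by simp
qed

lemma continuous_on_Ici_of_derivative:
  fixes f :: "real \<Rightarrow> 'a::real_normed_vector"
  assumes "\<And>t. t \<ge> a \<Longrightarrow> (f has_vector_derivative f' t) (at t within {a..})"
  shows "continuous_on {a..} f"
  by (intro continuous_on_vector_derivative [of _ f f']) (use assms in auto)

text \<open>The function \<open>F t - K * t\<close> is nonincreasing on the interval. Lower bounds
  on increments are obtained by applying this to \<open>- F\<close>.\<close>

lemma increment_le_of_derivative_le: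
  fixes F f :: "real \<Rightarrow> real"
  assumes "c \<le> a" "a \<le> b"
    and "\<And>t. t \<ge> c \<Longrightarrow> (F has_vector_derivative f t) (at t within {c..})"
    and "\<And>t. a \<le> t \<Longrightarrow> t \<le> b \<Longrightarrow> f t \<le> K"
  shows "F b - F a \<le> K * (b - a)"
proof -
  have "continuous_on {a..b} (\<lambda>t. F t - K * t)"
    using continuous_on_subset [OF continuous_on_Ici_of_derivative [OF assms(3)], of "{a..b}"] assms(1)
    by (intro continuous_intros) auto
  moreover have "((\<lambda>t. F t - K * t) has_real_derivative (f t - K)) (at t)" if "a < t" "t < b" for t
    using has_vector_derivative_at_interior_Ici [OF assms(3), of t] that assms(1)
    unfolding has_real_derivative_iff_has_vector_derivative [symmetric]
    by (auto intro!: derivative_eq_intros)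
  moreover have "f t - K \<le> 0" if "a < t" "t < b" for t
    using assms(4) [of t] that by auto
  ultimately have "F b - K * b \<le> F a - K * a"
    using DERIV_nonpos_imp_decreasing_open [OF assms(2), of "\<lambda>t. F t - K * t"] by blast
  then show ?thesis by (simp add: algebra_simps)
qed

section \<open>Wirtinger-based integral inequality\<close>

text \<open>The Wirtinger-based integral inequality (\<open>G\<close> is an antiderivative of a majorant of
  \<open>d\<^sup>T R d\<close>, where \<open>d = y'\<close>). The auxiliary function below is an antiderivative of the quadratic
  form of \<open>d\<close> minus its \<open>L\<^sup>2\<close>-projection \<open>u + 3 p v\<close> onto the affine functions, \<open>p\<close> being the
  first Legendre polynomial of the interval.\<close>

lemma wirtinger_integral_inequality:
  fixes y d Y :: "real \<Rightarrow> real^'n" and G g :: "real \<Rightarrow> real"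
  assumes ab: "a < b" and sym: "transpose R = R" and psd: "\<And>v. quad_form R v \<ge> 0"
    and cont: "continuous_on {a..b} y" "continuous_on {a..b} Y" "continuous_on {a..b} G"
    and y: "\<And>t. a < t \<Longrightarrow> t < b \<Longrightarrow> (y has_vector_derivative d t) (at t)"
    and Y: "\<And>t. a < t \<Longrightarrow> t < b \<Longrightarrow> (Y has_vector_derivative y t) (at t)"
    and G: "\<And>t. a < t \<Longrightarrow> t < b \<Longrightarrow> (G has_real_derivative g t) (at t)"
    and g: "\<And>t. a < t \<Longrightarrow> t < b \<Longrightarrow> quad_form R (d t) \<le> g t"
  shows "quad_form R (y b - y a) + 3 * quad_form R (y b + y a - (2 / (b - a)) *\<^sub>R (Y b - Y a))
    \<le> (b - a) * (G b - G a)"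
proof -
  define h where "h = b - a"
  have h: "h > 0" using ab by (simp add: h_def)
  define u where "u = (1 / h) *\<^sub>R (y b - y a)"
  \<comment> \<open>Integrating by parts, \<open>h *\<^sub>R v\<close> is the integral of
    \<open>p s *\<^sub>R d s\<close>; the square of \<open>p\<close> integrates to
    \<open>h / 3\<close>, which explains the coefficient 3 of \<open>v\<close> in the
    projection.\<close>
  define v where "v = (1 / h) *\<^sub>R (y b + y a - (2 / h) *\<^sub>R (Y b - Y a))"
  define p where "p s = (2 * s - a - b) / h" for s
  define ru where "ru = R *v u"
  define rv where "rv = R *v v"
  have ru: "u \<bullet> (R *v w) = ru \<bullet> w" "v \<bullet> (R *v w) = rv \<bullet> w"
      "w \<bullet> (R *v u) = ru \<bullet> w" "w \<bullet> (R *v v) = rv \<bullet> w" for w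
    using inner_symmetric_matrix [OF sym, of u w] inner_symmetric_matrix [OF sym, of v w]
    by (simp_all add: ru_def rv_def inner_commute)
  have rc: "ru \<bullet> v = rv \<bullet> u"
    using ru(2) [of u] by (simp add: ru_def inner_commute)
  define E where "E s = G s - 2 * (ru \<bullet> y s) - 6 * (rv \<bullet> (p s *\<^sub>R y s - (2 / h) *\<^sub>R Y s))
    + s * (ru \<bullet> u) + (3 * h / 2) * (rv \<bullet> v) * p s ^ 3 + (3 * h / 2) * (ru \<bullet> v) * p s ^ 2" for s
  \<comment> \<open>At \<open>w = d s\<close> and \<open>c = p s\<close>, the terms after the first
    are exactly the derivative of \<open>E s - G s\<close>.\<close>
  have q: "quad_form R (w - u - (3 * c) *\<^sub>R v) = quad_form R w - 2 * (ru \<bullet> w) - 6 * c * (rv \<bullet> w)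
      + ru \<bullet> u + 9 * c\<^sup>2 * (rv \<bullet> v) + 6 * c * (ru \<bullet> v)" for w c
    unfolding quad_form_def
    by (simp add: matrix_vector_mult_diff_distrib matrix_vector_mult_scaleR inner_diff_left
        inner_diff_right ru rc algebra_simps power2_eq_square)
  have "(E has_real_derivative g s - quad_form R (d s) + quad_form R (d s - u - (3 * p s) *\<^sub>R v)) (at s)"
    if s: "a < s" "s < b" for s
  proof -
    have p': "(p has_real_derivative 2 / h) (at s)"
      unfolding p_def using h by (auto intro!: derivative_eq_intros)
    have 1: "((\<lambda>s. ru \<bullet> y s) has_real_derivative ru \<bullet> d s) (at s)"
      unfolding has_real_derivative_iff_has_vector_derivative
      by (rule bounded_linear.has_vector_derivative [OF bounded_linear_inner_right y [OF s]])
    have 2: "((\<lambda>s. rv \<bullet> y s) has_real_derivative rv \<bullet> d s) (at s)"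
      unfolding has_real_derivative_iff_has_vector_derivative
      by (rule bounded_linear.has_vector_derivative [OF bounded_linear_inner_right y [OF s]])
    have 3: "((\<lambda>s. rv \<bullet> Y s) has_real_derivative rv \<bullet> y s) (at s)"
      unfolding has_real_derivative_iff_has_vector_derivative
      by (rule bounded_linear.has_vector_derivative [OF bounded_linear_inner_right Y [OF s]])
    show ?thesis
      unfolding E_def q inner_diff_right inner_scaleR_right using h
      by (auto intro!: derivative_eq_intros 1 2 3 p' G [OF s] simp: field_simps power2_eq_square)
  qed
  moreover have "g s - quad_form R (d s) + quad_form R (d s - u - (3 * p s) *\<^sub>R v) \<ge> 0"
    if "a < s" "s < b" for s
    using g [OF that] psd [of "d s - u - (3 * p s) *\<^sub>R v"] by simp
  moreover have "continuous_on {a..b} E"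
    unfolding E_def p_def using h by (intro continuous_intros cont) auto
  ultimately have "E a \<le> E b"
    using DERIV_nonneg_imp_increasing_open [of a b E] ab by (meson less_imp_le)
  moreover have pab: "p b = 1" "p a = -1"
    using h by (simp_all add: p_def h_def field_simps)
  \<comment> \<open>The mixed term drops out because \<open>p s ^ 2\<close> has the same value at
    both ends, reflecting the orthogonality of \<open>p\<close> to constants.\<close>
  moreover have "E b - E a = G b - G a - 2 * (ru \<bullet> (y b - y a))
      - 6 * (rv \<bullet> (y b + y a - (2 / h) *\<^sub>R (Y b - Y a))) + h * (ru \<bullet> u) + 3 * h * (rv \<bullet> v)"
    unfolding E_def pab h_def by (simp add: field_simps inner_diff_right inner_add_right)
  moreover have "y b - y a = h *\<^sub>R u" "y b + y a - (2 / h) *\<^sub>R (Y b - Y a) = h *\<^sub>R v"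
    using h by (simp_all add: u_def v_def)
  ultimately have "h * (ru \<bullet> u) + 3 * h * (rv \<bullet> v) \<le> G b - G a"
    by simp
  then have "h * (h * (ru \<bullet> u) + 3 * h * (rv \<bullet> v)) \<le> h * (G b - G a)"
    using h by (intro mult_left_mono) auto
  moreover have "quad_form R (h *\<^sub>R u) = h * (h * (ru \<bullet> u))" "quad_form R (h *\<^sub>R v) = h * (h * (rv \<bullet> v))"
    by (simp_all add: quad_form_def matrix_vector_mult_scaleR ru)
  ultimately show ?thesis
    unfolding h_def [symmetric] \<open>y b - y a = _\<close> \<open>y b + y a - _ = _\<close> by (simp add: algebra_simps)
qed

section \<open>Growth over the first delay interval\<close>

text \<open>If the weighted supremum \<open>T\<close> of \<open>norm (x t) * exp (- c * t)\<close> exceeded \<open>M\<close>, integrating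
  \<open>norm (x' t) \<le> c * T * exp (c * t)\<close> up to the point where it is attained would give \<open>T \<le> M\<close>.\<close>

lemma delay_growth_bound:
  fixes x x' :: "real \<Rightarrow> 'a::real_normed_vector"
  assumes h: "h > 0" and c: "c \<ge> 0"
    and hist: "\<And>t. - h \<le> t \<Longrightarrow> t \<le> 0 \<Longrightarrow> norm (x t) \<le> M"
    and x: "\<And>t. t \<ge> 0 \<Longrightarrow> (x has_vector_derivative x' t) (at t within {0..})"
    and x': "\<And>t K. 0 \<le> t \<Longrightarrow> (\<And>s. t - h \<le> s \<Longrightarrow> s \<le> t \<Longrightarrow> norm (x s) \<le> K) \<Longrightarrow> norm (x' t) \<le> c * K"
    and t: "0 \<le> t" "t \<le> h"
  shows "norm (x t) \<le> M * exp (c * t)"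
proof -
  have contx: "continuous_on {0..} x"
    using x by (rule continuous_on_Ici_of_derivative)
  have "continuous_on {0..h} (\<lambda>t. norm (x t) * exp (- c * t))"
    using continuous_on_subset [OF contx, of "{0..h}"] by (intro continuous_intros) auto
  then obtain t0 where t0: "t0 \<in> {0..h}"
    and max: "\<And>t. t \<in> {0..h} \<Longrightarrow> norm (x t) * exp (- c * t) \<le> norm (x t0) * exp (- c * t0)"
    using continuous_attains_sup [of "{0..h}" "\<lambda>t. norm (x t) * exp (- c * t)"] h by auto
  define T where "T = norm (x t0) * exp (- c * t0)"
  have xT: "norm (x t) \<le> T * exp (c * t)" if "t \<in> {0..h}" for t
    using max [OF that] by (simp add: T_def exp_minus field_simps)
  have M: "M \<ge> 0" using hist [of 0] h norm_ge_zero [of "x 0"] by linarith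
  have "T \<le> M"
  proof (rule ccontr)
    assume "\<not> T \<le> M"
    then have TM: "T > M" by simp
    have "norm (x' t) \<le> c * (T * exp (c * t))" if t: "t \<in> {0..h}" for t
    proof (rule x')
      fix s assume s: "t - h \<le> s" "s \<le> t"
      show "norm (x s) \<le> T * exp (c * t)"
      proof (cases "s \<le> 0")
        case True
        then have "norm (x s) \<le> T" using hist [of s] s t TM by auto
        also have "\<dots> \<le> T * exp (c * t)" using TM M c t by (simp add: mult_le_cancel_left1)
        finally show ?thesis .
      next
        case False
        then have "norm (x s) \<le> T * exp (c * s)" using s t by (intro xT) auto
        also have "\<dots> \<le> T * exp (c * t)" using TM M c s by (intro mult_left_mono) (auto intro: mult_left_mono)
        finally show ?thesis .
      qed
    qed (use t in auto)
    note bound = this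
    have "norm (x t0 - x 0) \<le> T * exp (c * t0) - T * exp (c * 0)"
    \<comment> \<open>The mean value bound is applied on a nondegenerate interval; at
      \<open>t0 = 0\<close> both sides are zero.\<close>
    proof (cases "t0 = 0")
      case False
      show ?thesis
      proof (rule differentiable_bound_general [where f' = x' and \<phi>' = "\<lambda>t. c * (T * exp (c * t))"])
        show "0 < t0" using False t0 by auto
        show "continuous_on {0..t0} x" using contx by (rule continuous_on_subset) auto
        show "continuous_on {0..t0} (\<lambda>t. T * exp (c * t))" by (intro continuous_intros)
      next
        fix s assume s: "0 < s" "s < t0"
        show "(x has_vector_derivative x' s) (at s)"
          using s by (intro has_vector_derivative_at_interior_Ici [OF x]) auto
        show "((\<lambda>t. T * exp (c * t)) has_vector_derivative c * (T * exp (c * s))) (at s)"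
          unfolding has_real_derivative_iff_has_vector_derivative [symmetric]
          by (auto intro!: derivative_eq_intros)
        show "norm (x' s) \<le> c * (T * exp (c * s))"
          using s t0 by (intro bound) auto
      qed
    qed simp
    moreover have "norm (x t0) \<le> norm (x 0) + norm (x t0 - x 0)"
      using norm_triangle_ineq [of "x 0" "x t0 - x 0"] by simp
    moreover have "norm (x t0) = T * exp (c * t0)" by (simp add: T_def exp_minus)
    ultimately show False using hist [of 0] h TM by simp
  qed
  have "norm (x t) \<le> T * exp (c * t)" using t by (intro xT) auto
  also have "\<dots> \<le> M * exp (c * t)" using \<open>T \<le> M\<close> by simp
  finally show ?thesis .
qed

section \<open>Lyapunov-Krasovskii functional along a trajectory\<close>

text \<open>With \<open>J' = G\<close>, the term \<open>h * G t - (J t - J (t - h))\<close> is the double integral of \<open>g = G'\<close>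
  over \<open>t + \<theta> \<le> s \<le> t\<close>, \<open>- h \<le> \<theta> \<le> 0\<close> in the Lyapunov-Krasovskii functional.\<close>

definition lk_functional ::
  "real^('n + 'n)^('n + 'n) \<Rightarrow> real \<Rightarrow> real \<Rightarrow> (real \<Rightarrow> real^'n) \<Rightarrow> (real \<Rightarrow> real^'n)
    \<Rightarrow> (real \<Rightarrow> real) \<Rightarrow> (real \<Rightarrow> real) \<Rightarrow> (real \<Rightarrow> real) \<Rightarrow> real \<Rightarrow> real" where
  "lk_functional P \<alpha> h y Y Q G J t =
     exp (2 * \<alpha> * t) * quad_form P (vjoin (y t) (Y t - Y (t - h)))
     + (Q t - Q (t - h)) + h * (h * G t - (J t - J (t - h)))"

text \<open>Antiderivatives replace integrals over the delay window, so that these become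
  differences such as \<open>Q t - Q (t - h)\<close>, to which the chain rule applies. Since the
  data live on \<open>t \<ge> 0\<close>, such differences make sense from \<open>t = h\<close>
  on.\<close>

locale lk_trajectory =
  fixes P :: "real^('n::finite + 'n)^('n + 'n)" and R S :: "real^'n^'n" and h \<alpha> :: real
    and y d Y :: "real \<Rightarrow> real^'n" and Q G J :: "real \<Rightarrow> real"
  assumes h: "h > 0" and \<alpha>: "\<alpha> \<ge> 0"
    and P: "pos_def P" and R: "pos_def R" and S: "pos_def S"
    and y: "\<And>t. t \<ge> 0 \<Longrightarrow> (y has_vector_derivative d t) (at t within {0..})"
    and Y: "\<And>t. t \<ge> 0 \<Longrightarrow> (Y has_vector_derivative y t) (at t within {0..})"
    and Q: "\<And>t. t \<ge> 0 \<Longrightarrow>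
      (Q has_vector_derivative exp (2 * \<alpha> * t) * quad_form S (y t)) (at t within {0..})"
    and G: "\<And>t. t \<ge> 0 \<Longrightarrow>
      (G has_vector_derivative exp (2 * \<alpha> * t) * quad_form R (d t)) (at t within {0..})"
    and J: "\<And>t. t \<ge> 0 \<Longrightarrow> (J has_vector_derivative G t) (at t within {0..})"
begin

lemma R_nonneg: "quad_form R v \<ge> 0" and S_nonneg: "quad_form S v \<ge> 0"
  using R S by (cases "v = 0"; force simp: pos_def_def quad_form_def less_imp_le)+

text \<open>As \<open>\<alpha>\<close> is nonnegative, the weight
  \<open>exp (2 * \<alpha> * s)\<close> on the window is at least its value at the left end
  \<open>t - h\<close>. The integral inequality is applied to \<open>R\<close> scaled by that
  constant, with the weighted form as majorant.\<close>

lemma wirtinger_weighted: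
  assumes "t > h"
  shows "exp (2 * \<alpha> * (t - h)) * (quad_form R (y t - y (t - h))
      + 3 * quad_form R (y t + y (t - h) - (2 / h) *\<^sub>R (Y t - Y (t - h)))) \<le> h * (G t - G (t - h))"
proof -
  let ?k = "exp (2 * \<alpha> * (t - h))"
  have cont: "continuous_on {t - h..t} f" if "continuous_on {0..} f" for f :: "real \<Rightarrow> 'b::topological_space"
    using that by (rule continuous_on_subset) (use assms in auto)
  have "quad_form (?k *\<^sub>R R) (y t - y (t - h))
      + 3 * quad_form (?k *\<^sub>R R) (y t + y (t - h) - (2 / (t - (t - h))) *\<^sub>R (Y t - Y (t - h)))
    \<le> (t - (t - h)) * (G t - G (t - h))"
  proof (rule wirtinger_integral_inequality
      [where d = d and g = "\<lambda>s. exp (2 * \<alpha> * s) * quad_form R (d s)"])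
    show "t - h < t" using h by simp
    show "transpose (?k *\<^sub>R R) = ?k *\<^sub>R R"
      using R by (simp add: pos_def_def vec_eq_iff transpose_def)
    show "0 \<le> quad_form (?k *\<^sub>R R) v" for v
      by (simp add: quad_form_scaleR R_nonneg)
    show "continuous_on {t - h..t} y" "continuous_on {t - h..t} Y" "continuous_on {t - h..t} G"
      by (intro cont continuous_on_Ici_of_derivative, erule y Y G)+
  next
    fix s assume s: "t - h < s" "s < t"
    then have s0: "s > 0" using assms by simp
    show "(y has_vector_derivative d s) (at s)" "(Y has_vector_derivative y s) (at s)"
      using s0 by (auto intro!: has_vector_derivative_at_interior_Ici [OF y]
          has_vector_derivative_at_interior_Ici [OF Y])
    show "(G has_real_derivative exp (2 * \<alpha> * s) * quad_form R (d s)) (at s)"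
      unfolding has_real_derivative_iff_has_vector_derivative
      using s0 by (auto intro!: has_vector_derivative_at_interior_Ici [OF G])
    have "2 * \<alpha> * (t - h) \<le> 2 * \<alpha> * s"
      using s \<alpha> by (intro mult_left_mono) auto
    then show "quad_form (?k *\<^sub>R R) (d s) \<le> exp (2 * \<alpha> * s) * quad_form R (d s)"
      unfolding quad_form_scaleR by (intro mult_right_mono R_nonneg) simp
  qed
  then show ?thesis by (simp add: quad_form_scaleR algebra_simps)
qed

text \<open>Differentiating the exponential weight gives the summand
  \<open>\<alpha> *\<^sub>R \<eta>\<close>, and differentiating \<open>J t - J (t - h)\<close> gives
  the increment of \<open>G\<close>.\<close>

lemma lk_functional_derivative:
  assumes "t > h"
  defines "\<eta> \<equiv> vjoin (y t) (Y t - Y (t - h))"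
  shows "(lk_functional P \<alpha> h y Y Q G J has_real_derivative
    exp (2 * \<alpha> * t) * (2 * (\<eta> \<bullet> (P *v (vjoin (d t) (y t - y (t - h)) + \<alpha> *\<^sub>R \<eta>))) + quad_form S (y t)
      + h\<^sup>2 * quad_form R (d t))
    - exp (2 * \<alpha> * (t - h)) * quad_form S (y (t - h)) - h * (G t - G (t - h))) (at t)"
proof -
  have t: "t > 0" "t - h > 0" using assms h by auto
  have shift: "((\<lambda>t. f (t - h)) has_vector_derivative f') (at t)"
    if "(f has_vector_derivative f') (at (t - h))" for f :: "real \<Rightarrow> 'b::real_normed_vector" and f'
  proof -
    have "((\<lambda>t. t - h) has_vector_derivative 1) (at t)"
      by (auto intro!: derivative_eq_intros)
    from vector_diff_chain_at [OF this that] show ?thesis by (simp add: o_def)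
  qed
  note at = has_vector_derivative_at_interior_Ici
  note D = at [OF y [OF less_imp_le, OF t(1)] t(1)] at [OF Y [OF less_imp_le, OF t(1)] t(1)]
    at [OF Q [OF less_imp_le, OF t(1)] t(1)] at [OF G [OF less_imp_le, OF t(1)] t(1)]
    at [OF J [OF less_imp_le, OF t(1)] t(1)]
  note Dh = shift [OF at [OF Y [OF less_imp_le, OF t(2)] t(2)]]
    shift [OF at [OF Q [OF less_imp_le, OF t(2)] t(2)]] shift [OF at [OF J [OF less_imp_le, OF t(2)] t(2)]]
  have "transpose P = P" using P by (simp add: pos_def_def)
  from has_real_derivative_quad_form [OF this
      has_vector_derivative_vjoin [OF D(1) has_vector_derivative_diff [OF D(2) Dh(1)]]]
  have "((\<lambda>t. quad_form P (vjoin (y t) (Y t - Y (t - h)))) has_real_derivative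
      2 * (\<eta> \<bullet> (P *v vjoin (d t) (y t - y (t - h))))) (at t)"
    by (simp add: \<eta>_def)
  moreover note D(3-5) [folded has_real_derivative_iff_has_vector_derivative]
    Dh(2-3) [folded has_real_derivative_iff_has_vector_derivative]
  ultimately show ?thesis
    unfolding lk_functional_def
    by (auto intro!: derivative_eq_intros simp: \<eta>_def [symmetric] quad_form_def
        matrix_vector_right_distrib matrix_vector_mult_scaleR inner_add_right algebra_simps
        power2_eq_square)
qed

lemma lk_functional_antimono:
  assumes lmi: "\<And>t. t > h \<Longrightarrow> quad_form (Phi P R S \<alpha> h)
      (vjoin (y t) (vjoin (y (t - h)) (vjoin (d t) ((1 / h) *\<^sub>R (Y t - Y (t - h)))))) \<le> 0"
    and t: "t \<ge> h"
  shows "lk_functional P \<alpha> h y Y Q G J t \<le> lk_functional P \<alpha> h y Y Q G J h"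
proof -
  have cont: "continuous_on {h..t} f" "continuous_on {h..t} (\<lambda>t. f (t - h))"
    if "continuous_on {0..} f" for f :: "real \<Rightarrow> 'b::topological_space"
  proof -
    show "continuous_on {h..t} f"
      using that by (rule continuous_on_subset) (use h in auto)
    show "continuous_on {h..t} (\<lambda>t. f (t - h))"
      by (rule continuous_on_compose2 [OF that]) (auto intro!: continuous_intros)
  qed
  note C = continuous_on_Ici_of_derivative [OF y] continuous_on_Ici_of_derivative [OF Y]
    continuous_on_Ici_of_derivative [OF Q] continuous_on_Ici_of_derivative [OF G]
    continuous_on_Ici_of_derivative [OF J]
  \<comment> \<open>At \<open>h\<close> the shifted functions are evaluated at 0, where only
    one-sided derivatives are known; continuity takes care of this endpoint.\<close>
  have "continuous_on {h..t} (lk_functional P \<alpha> h y Y Q G J)"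
    unfolding lk_functional_def
    by (intro continuous_intros continuous_on_vjoin cont(1) [OF C(1)] cont [OF C(2)]
        cont [OF C(3)] cont(1) [OF C(4)] cont [OF C(5)])
  moreover have "\<exists>D. (lk_functional P \<alpha> h y Y Q G J has_real_derivative D) (at s) \<and> D \<le> 0"
    if s: "h < s" "s < t" for s
  proof (intro exI conjI, rule lk_functional_derivative [OF s(1)])
    let ?e = "exp (2 * \<alpha> * s)" and ?w = "(1 / h) *\<^sub>R (Y s - Y (s - h))"
    let ?\<eta> = "vjoin (y s) (Y s - Y (s - h))"
    \<comment> \<open>The ratio of the weights at \<open>s - h\<close> and \<open>s\<close> is the
      exponential factor occurring in \<open>Phi\<close>.\<close>
    have e: "exp (2 * \<alpha> * (s - h)) = ?e * exp (- 2 * \<alpha> * h)"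
      by (simp add: exp_add [symmetric] algebra_simps)
    have w: "h *\<^sub>R ?w = Y s - Y (s - h)" "2 *\<^sub>R ?w = (2 / h) *\<^sub>R (Y s - Y (s - h))"
      using h by simp_all
    \<comment> \<open>The weighted integral inequality bounds the increment of \<open>G\<close> from
      below and so supplies the negative \<open>F2\<close> term of \<open>Phi\<close>.\<close>
    have "?e * (2 * (?\<eta> \<bullet> (P *v (vjoin (d s) (y s - y (s - h)) + \<alpha> *\<^sub>R ?\<eta>))) + quad_form S (y s)
          + h\<^sup>2 * quad_form R (d s)) - exp (2 * \<alpha> * (s - h)) * quad_form S (y (s - h)) - h * (G s - G (s - h))
        \<le> ?e * quad_form (Phi P R S \<alpha> h) (vjoin (y s) (vjoin (y (s - h)) (vjoin (d s) ?w)))"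
      using wirtinger_weighted [OF s(1)] unfolding quad_form_Phi w e by (simp add: algebra_simps)
    also have "\<dots> \<le> 0"
      using lmi [OF s(1)] by (simp add: mult_le_0_iff)
    finally show "?e * (2 * (?\<eta> \<bullet> (P *v (vjoin (d s) (y s - y (s - h)) + \<alpha> *\<^sub>R ?\<eta>))) + quad_form S (y s)
          + h\<^sup>2 * quad_form R (d s)) - exp (2 * \<alpha> * (s - h)) * quad_form S (y (s - h))
          - h * (G s - G (s - h)) \<le> 0" .
  qed
  ultimately show ?thesis
    using DERIV_nonpos_imp_decreasing_open [OF t, of "lk_functional P \<alpha> h y Y Q G J"] by blast
qed

lemma G_mono:
  assumes "0 \<le> s" "s \<le> t"
  shows "G s \<le> G t"
proof -
  have "- G t - - G s \<le> 0 * (t - s)"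
    by (rule increment_le_of_derivative_le
        [where c = 0 and f = "\<lambda>t. - (exp (2 * \<alpha> * t) * quad_form R (d t))"])
      (use assms R_nonneg in \<open>auto intro!: has_vector_derivative_minus G\<close>)
  then show ?thesis by simp
qed

text \<open>Both integral terms are nonnegative: \<open>Q\<close> is nondecreasing, and as
  \<open>G\<close> is nondecreasing, \<open>J t - J (t - h)\<close> is at most
  \<open>h * G t\<close>.\<close>

lemma lk_functional_ge:
  assumes "t \<ge> h"
  shows "exp (2 * \<alpha> * t) * quad_form P (vjoin (y t) (Y t - Y (t - h))) \<le> lk_functional P \<alpha> h y Y Q G J t"
proof -
  have "- Q t - - Q (t - h) \<le> 0 * (t - (t - h))"
    by (rule increment_le_of_derivative_le
        [where c = 0 and f = "\<lambda>t. - (exp (2 * \<alpha> * t) * quad_form S (y t))"])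
      (use assms h S_nonneg in \<open>auto intro!: has_vector_derivative_minus Q\<close>)
  moreover have "J t - J (t - h) \<le> G t * (t - (t - h))"
    by (rule increment_le_of_derivative_le [where c = 0 and f = G])
      (use assms h in \<open>auto intro!: J G_mono\<close>)
  ultimately show ?thesis
    using h mult_left_mono [of "J t - J (t - h)" "h * G t" h]
    by (simp add: lk_functional_def algebra_simps)
qed

text \<open>At time \<open>h\<close> the functional depends only on the trajectory over
  \<open>[0, h]\<close>. The factor of the squared bound is independent of the trajectory, which
  makes the final decay constant uniform.\<close>

lemma lk_functional_initial_le:
  assumes M: "\<And>t. 0 \<le> t \<Longrightarrow> t \<le> h \<Longrightarrow> norm (y t) \<le> M \<and> norm (d t) \<le> M"
    and cP: "cP \<ge> 0" "\<And>v. quad_form P v \<le> cP * (norm v)\<^sup>2"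
    and cR: "cR \<ge> 0" "\<And>v. quad_form R v \<le> cR * (norm v)\<^sup>2"
    and cS: "cS \<ge> 0" "\<And>v. quad_form S v \<le> cS * (norm v)\<^sup>2"
  shows "lk_functional P \<alpha> h y Y Q G J h
    \<le> exp (2 * \<alpha> * h) * (cP * (1 + h\<^sup>2) + h * cS + h\<^sup>2 * (h * cR)) * M\<^sup>2"
proof -
  let ?e = "exp (2 * \<alpha> * h)"
  have qle: "exp (2 * \<alpha> * t) * quad_form N v \<le> ?e * (c * M\<^sup>2)"
    if "t \<le> h" "norm v \<le> M" "c \<ge> 0" "\<And>v. quad_form N v \<le> c * (norm v)\<^sup>2" "quad_form N v \<ge> 0"
    for t N c and v :: "real^'n"
  proof (intro mult_mono)
    show "exp (2 * \<alpha> * t) \<le> ?e" using \<alpha> that by (auto intro: mult_left_mono)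
    have "(norm v)\<^sup>2 \<le> M\<^sup>2" using that by (intro power_mono) auto
    then have "c * (norm v)\<^sup>2 \<le> c * M\<^sup>2" using that by (intro mult_left_mono) auto
    then show "quad_form N v \<le> c * M\<^sup>2" using that(4) [of v] by linarith
  qed (use that in auto)
  have "Q h - Q 0 \<le> (?e * (cS * M\<^sup>2)) * (h - 0)"
    by (rule increment_le_of_derivative_le [OF _ _ Q]) (use h M cS S_nonneg in \<open>auto intro!: qle\<close>)
  moreover have "G h - G 0 \<le> (?e * (cR * M\<^sup>2)) * (h - 0)"
    by (rule increment_le_of_derivative_le [OF _ _ G]) (use h M cR R_nonneg in \<open>auto intro!: qle\<close>)
  then have "h\<^sup>2 * (G h - G 0) \<le> h\<^sup>2 * ((?e * (cR * M\<^sup>2)) * (h - 0))"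
    by (intro mult_left_mono) auto
  \<comment> \<open>Since \<open>G\<close> is nondecreasing, \<open>J h - J 0\<close> is at least
    \<open>h * G 0\<close>, so the double-integral term is at most
    \<open>h\<^sup>2 * (G h - G 0)\<close>.\<close>
  moreover have "- J h - - J 0 \<le> - G 0 * (h - 0)"
    by (rule increment_le_of_derivative_le [where c = 0 and f = "\<lambda>t. - G t"])
      (use h in \<open>auto intro!: has_vector_derivative_minus J G_mono\<close>)
  then have "h * (- J h - - J 0) \<le> h * (- G 0 * (h - 0))"
    using h by (intro mult_left_mono) auto
  \<comment> \<open>This bound on the integral of \<open>y\<close> is the source of the summand
    \<open>h\<^sup>2\<close> in \<open>1 + h\<^sup>2\<close>.\<close>
  moreover have "norm (Y h - Y 0) \<le> M * h - M * 0"
  proof (rule differentiable_bound_general [where f' = y and \<phi>' = "\<lambda>t. M"])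
    show "continuous_on {0..h} Y"
      using continuous_on_Ici_of_derivative [OF Y] by (rule continuous_on_subset) auto
  next
    fix s assume "0 < s" "s < h"
    then show "(Y has_vector_derivative y s) (at s)" "norm (y s) \<le> M"
      using M by (auto intro!: has_vector_derivative_at_interior_Ici [OF Y])
    show "((\<lambda>t. M * t) has_vector_derivative M) (at s)"
      unfolding has_real_derivative_iff_has_vector_derivative [symmetric]
      by (auto intro!: derivative_eq_intros)
  qed (use h in \<open>auto intro!: continuous_intros\<close>)
  then have "(norm (Y h - Y 0))\<^sup>2 \<le> (M * h)\<^sup>2"
    by (intro power_mono) auto
  moreover have "(norm (y h))\<^sup>2 \<le> M\<^sup>2"
    using M [of h] h by (intro power_mono) auto
  moreover have "(norm (vjoin (y h) (Y h - Y 0)))\<^sup>2 = (norm (y h))\<^sup>2 + (norm (Y h - Y 0))\<^sup>2"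
    by (simp only: power2_norm_eq_inner inner_vjoin)
  ultimately have "(norm (vjoin (y h) (Y h - Y 0)))\<^sup>2 \<le> M\<^sup>2 + (M * h)\<^sup>2"
    by linarith
  then have "cP * (norm (vjoin (y h) (Y h - Y 0)))\<^sup>2 \<le> cP * (M\<^sup>2 + (M * h)\<^sup>2)"
    using cP by (intro mult_left_mono) auto
  with cP(2) [of "vjoin (y h) (Y h - Y 0)"]
  have "?e * quad_form P (vjoin (y h) (Y h - Y 0)) \<le> ?e * (cP * (M\<^sup>2 + (M * h)\<^sup>2))"
    by (intro mult_left_mono) auto
  with \<open>Q h - Q 0 \<le> _\<close> \<open>h\<^sup>2 * (G h - G 0) \<le> _\<close> \<open>h * (- J h - - J 0) \<le> _\<close>
  show ?thesis
    by (simp add: lk_functional_def algebra_simps power2_eq_square)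
qed

end

section \<open>Uniform exponential decay\<close>

text \<open>Of the dynamics only the sign of the quadratic form is retained. Continuity of
  \<open>d\<close> provides the antiderivative \<open>G\<close> of its weighted form.\<close>

definition admissible_trajectory ::
  "real^('n::finite + 'n)^('n + 'n) \<Rightarrow> real^'n^'n \<Rightarrow> real^'n^'n \<Rightarrow> real \<Rightarrow> real
    \<Rightarrow> (real \<Rightarrow> real^'n) \<Rightarrow> (real \<Rightarrow> real^'n) \<Rightarrow> (real \<Rightarrow> real^'n) \<Rightarrow> bool" where
  "admissible_trajectory P R S \<alpha> h y d Y \<longleftrightarrow>
     (\<forall>t\<ge>0. (y has_vector_derivative d t) (at t within {0..})) \<and>
     (\<forall>t\<ge>0. (Y has_vector_derivative y t) (at t within {0..})) \<and>
     continuous_on {0..} d \<and>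
     (\<forall>t>h. quad_form (Phi P R S \<alpha> h)
        (vjoin (y t) (vjoin (y (t - h)) (vjoin (d t) ((1 / h) *\<^sub>R (Y t - Y (t - h)))))) \<le> 0)"

text \<open>The constant is chosen before the trajectory. Coercivity of \<open>P\<close> bounds the
  functional from below, monotonicity compares it with its value at \<open>h\<close>, and that value
  is at most a constant times the square of \<open>M\<close>.\<close>

lemma lk_decay:
  fixes P :: "real^('n::finite + 'n)^('n + 'n)" and R S :: "real^'n^'n" and h \<alpha> :: real
  assumes h: "h > 0" and \<alpha>: "\<alpha> \<ge> 0"
    and P: "pos_def P" and R: "pos_def R" and S: "pos_def S"
  shows "\<exists>C\<ge>0. \<forall>y d Y M. admissible_trajectory P R S \<alpha> h y d Y
    \<longrightarrow> (\<forall>t\<in>{0..h}. norm (y t) \<le> M \<and> norm (d t) \<le> M)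
    \<longrightarrow> (\<forall>t\<ge>h. norm (y t) \<le> C * exp (- \<alpha> * t) * M)"
proof -
  obtain c where c: "c > 0" "\<And>v. c * (norm v)\<^sup>2 \<le> quad_form P v"
    using pos_def_coercive [OF P] by blast
  obtain cP where cP: "cP > 0" "\<And>v. quad_form P v \<le> cP * (norm v)\<^sup>2" using quad_form_le by blast
  obtain cR where cR: "cR > 0" "\<And>v. quad_form R v \<le> cR * (norm v)\<^sup>2" using quad_form_le by blast
  obtain cS where cS: "cS > 0" "\<And>v. quad_form S v \<le> cS * (norm v)\<^sup>2" using quad_form_le by blast
  define C0 where "C0 = exp (2 * \<alpha> * h) * (cP * (1 + h\<^sup>2) + h * cS + h\<^sup>2 * (h * cR))"
  have C0: "C0 \<ge> 0" using h cP cR cS by (simp add: C0_def)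
  show ?thesis
  proof (intro exI conjI allI impI)
    \<comment> \<open>The witness comes from comparing
      \<open>c * exp (2 * \<alpha> * t) * (norm (y t))\<^sup>2\<close> with
      \<open>C0 * M\<^sup>2\<close>; the square root also halves the rate to
      \<open>\<alpha>\<close>.\<close>
    show "sqrt (C0 / c) \<ge> 0" using C0 c by simp
  next
    fix y d Y :: "real \<Rightarrow> real^'n" and M t :: real
    assume adm: "admissible_trajectory P R S \<alpha> h y d Y"
      and M': "\<forall>t\<in>{0..h}. norm (y t) \<le> M \<and> norm (d t) \<le> M" and t: "h \<le> t"
    have M: "\<And>t. 0 \<le> t \<Longrightarrow> t \<le> h \<Longrightarrow> norm (y t) \<le> M \<and> norm (d t) \<le> M"
      using M' by simp
    have y: "\<And>t. t \<ge> 0 \<Longrightarrow> (y has_vector_derivative d t) (at t within {0..})"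
      and Y: "\<And>t. t \<ge> 0 \<Longrightarrow> (Y has_vector_derivative y t) (at t within {0..})"
      and d: "continuous_on {0..} d"
      and lmi: "\<And>t. t > h \<Longrightarrow> quad_form (Phi P R S \<alpha> h)
            (vjoin (y t) (vjoin (y (t - h)) (vjoin (d t) ((1 / h) *\<^sub>R (Y t - Y (t - h)))))) \<le> 0"
      using adm by (auto simp: admissible_trajectory_def)
    have "continuous_on {0..} (\<lambda>t. exp (2 * \<alpha> * t) * quad_form S (y t))"
      by (intro continuous_intros continuous_on_Ici_of_derivative [OF y])
    then obtain Q where Q: "\<And>t. t \<ge> 0 \<Longrightarrow>
        (Q has_vector_derivative exp (2 * \<alpha> * t) * quad_form S (y t)) (at t within {0..})"
      using antiderivative_Ici by blast
    have "continuous_on {0..} (\<lambda>t. exp (2 * \<alpha> * t) * quad_form R (d t))"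
      by (intro continuous_intros d)
    then obtain G where G: "\<And>t. t \<ge> 0 \<Longrightarrow>
        (G has_vector_derivative exp (2 * \<alpha> * t) * quad_form R (d t)) (at t within {0..})"
      using antiderivative_Ici by blast
    obtain J where J: "\<And>t. t \<ge> 0 \<Longrightarrow> (J has_vector_derivative G t) (at t within {0..})"
      using antiderivative_Ici [OF continuous_on_Ici_of_derivative [OF G]] by blast
    interpret lk_trajectory P R S h \<alpha> y d Y Q G J
      by unfold_locales (use h \<alpha> P R S y Y Q G J in auto)
    have "norm (y 0) \<le> M" using M [of 0] h by simp
    then have M0: "M \<ge> 0" using norm_ge_zero order_trans by blast
    let ?\<eta> = "vjoin (y t) (Y t - Y (t - h))"
    have "(norm (y t))\<^sup>2 \<le> (norm ?\<eta>)\<^sup>2"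
      by (simp only: power2_norm_eq_inner inner_vjoin) simp
    then have "c * (norm (y t))\<^sup>2 \<le> c * (norm ?\<eta>)\<^sup>2" using c by simp
    also have "\<dots> \<le> quad_form P ?\<eta>" by (rule c)
    finally have "exp (2 * \<alpha> * t) * (c * (norm (y t))\<^sup>2) \<le> exp (2 * \<alpha> * t) * quad_form P ?\<eta>"
      by simp
    also have "\<dots> \<le> lk_functional P \<alpha> h y Y Q G J h"
      using lk_functional_ge [OF t] lk_functional_antimono [OF lmi t] by linarith
    also have "\<dots> \<le> C0 * M\<^sup>2"
      unfolding C0_def by (rule lk_functional_initial_le [OF M]) (use cP cR cS in auto)
    finally have "(norm (y t))\<^sup>2 \<le> C0 / c * exp (- (2 * \<alpha> * t)) * M\<^sup>2"
      using c by (simp add: exp_minus field_simps)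
    also have "\<dots> = (sqrt (C0 / c) * exp (- \<alpha> * t) * M)\<^sup>2"
      using C0 c by (simp add: power_mult_distrib exp_double [symmetric])
    finally show "norm (y t) \<le> sqrt (C0 / c) * exp (- \<alpha> * t) * M"
      by (rule power2_le_imp_le) (use C0 c M0 in auto)
  qed
qed

section \<open>Stability of the closed loop\<close>

theorem theorem2:
  fixes A :: "real^'n^'n" and B :: "real^'m^'n"
    and h \<alpha> \<epsilon>1 \<epsilon>2 \<epsilon>3 \<epsilon>4 \<beta>1 :: real
    and P :: "real^('n + 'n)^('n + 'n)" and R S X :: "real^'n^'n" and Kbar :: "real^'n^'m"
  assumes "h > 0" and "\<alpha> \<ge> 0"
    and "pos_def P" and "pos_def R" and "pos_def S"
    and "invertible X" and "\<beta>1 > 0"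
    and "pos_def (P + (exp (- 2 * \<alpha> * h) / h) *\<^sub>R bdiag (0 :: real^'n^'n) S
           + R_coeff \<alpha> h *\<^sub>R ((h\<^sup>2 *\<^sub>R R   ||| - (h *\<^sub>R R))
                          === (- (h *\<^sub>R R) ||| R))
           - \<beta>1 *\<^sub>R bdiag (mat 1 :: real^'n^'n) (0 :: real^'n^'n))"
    and "neg_def (Phi P R S \<alpha> h
           + He (transpose ((A ||| (0 :: real^'n^'n) ||| - mat 1 ||| 0) ** bdiag X (bdiag X (bdiag X X))
                            + (0 ||| 0 ||| 0 ||| B ** Kbar))
                 ** (\<epsilon>1 *\<^sub>R mat 1 ||| \<epsilon>2 *\<^sub>R mat 1 ||| \<epsilon>3 *\<^sub>R mat 1 ||| \<epsilon>4 *\<^sub>R mat 1)))"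
  shows "alpha_stable \<alpha> h
           (\<lambda>x t. A *v x t + (1 / h) *\<^sub>R ((B ** (Kbar ** matrix_inv X)) *v integral {t - h..t} x))"
proof -
  note h = assms(1) and \<alpha> = assms(2) and P = assms(3) and R = assms(4) and S = assms(5) and X = assms(6)
  \<comment> \<open>Here \<open>K\<close> includes the factor \<open>B\<close>; it is not the
    feedback gain alone.\<close>
  define K where "K = B ** (Kbar ** matrix_inv X)"
  define X' where "X' = matrix_inv X"
  have XX': "X *v (X' *v v) = v" for v
    using matrix_mult_matrix_inv [OF X] by (simp add: X'_def matrix_vector_mul_assoc)
  obtain a where a: "a > 0" "\<And>v. norm (A *v v) \<le> norm v * a"
    using bounded_linear.pos_bounded [of "(*v) A"] by auto
  obtain k where k: "k > 0" "\<And>v. norm (K *v v) \<le> norm v * k"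
    using bounded_linear.pos_bounded [of "(*v) K"] by auto
  obtain b where b: "b > 0" "\<And>v. norm (X *v v) \<le> norm v * b"
    using bounded_linear.pos_bounded [of "(*v) X"] by auto
  obtain b' where b': "b' > 0" "\<And>v. norm (X' *v v) \<le> norm v * b'"
    using bounded_linear.pos_bounded [of "(*v) X'"] by auto
  obtain C where C: "C \<ge> 0" and decay: "\<And>y d Y M t. admissible_trajectory P R S \<alpha> h y d Y
      \<Longrightarrow> \<forall>t\<in>{0..h}. norm (y t) \<le> M \<and> norm (d t) \<le> M
      \<Longrightarrow> t \<ge> h \<Longrightarrow> norm (y t) \<le> C * exp (- \<alpha> * t) * M"
    using lk_decay [OF h \<alpha> P R S] by blast
  \<comment> \<open>This bounds the right-hand side relative to the supremum of the solution over
    the delay window: the integral is at most \<open>h\<close> times that supremum, which cancels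
    \<open>1 / h\<close>.\<close>
  define c where "c = a + k"
  have c: "c > 0" using a k by (simp add: c_def)
  \<comment> \<open>On \<open>[0, h]\<close>, \<open>exp (c * h)\<close> bounds the growth,
    \<open>1 + c\<close> covers both the solution and its derivative, and \<open>b'\<close> accounts
    for the change of coordinates.\<close>
  define L where "L = (1 + c) * exp (c * h) * b'"
  have L: "L > 0" using c b' by (simp add: L_def)
  \<comment> \<open>The first summand ensures \<open>\<gamma> \<ge> 1\<close>, the second serves
    times up to \<open>h\<close>, the third later times.\<close>
  define \<gamma> where "\<gamma> = 1 + exp (c * h) * exp (\<alpha> * h) + b * C * L"
  have \<gamma>1: "\<gamma> \<ge> 1" using b C L by (simp add: \<gamma>_def)
  \<comment> \<open>The premise is the closed-loop equation in the coordinates given by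
    \<open>X\<close>; \<open>z\<close> is free because its block in the left factor is zero.\<close>
  have lmi: "quad_form (Phi P R S \<alpha> h) (vjoin y (vjoin z (vjoin d w))) \<le> 0"
    if "A *v (X *v y) - X *v d + B *v (Kbar *v w) = 0" for y z d w
  proof -
    let ?v = "vjoin y (vjoin z (vjoin d w))"
    let ?M = "(A ||| (0 :: real^'n^'n) ||| - mat 1 ||| 0) ** bdiag X (bdiag X (bdiag X X))
      + (0 ||| 0 ||| 0 ||| B ** Kbar)"
    have "?M *v ?v = A *v (X *v y) - X *v d + B *v (Kbar *v w)"
      unfolding matrix_vector_mult_add_rdistrib matrix_vector_mul_assoc [symmetric]
        bdiag_mult_vjoin hcat_mult_vjoin uminus_matrix_mult_vec by simp
    then have "quad_form (He (transpose ?M ** N)) ?v = 0" for N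
      using that by (intro quad_form_He_eq_0) simp
    moreover have "quad_form N v \<le> 0" if "neg_def N" for N v
      using that by (cases "v = 0") (auto simp: neg_def_def quad_form_def less_imp_le)
    from this [OF assms(9), of ?v] have "quad_form (Phi P R S \<alpha> h) ?v
        + quad_form (He (transpose ?M ** (\<epsilon>1 *\<^sub>R mat 1 ||| \<epsilon>2 *\<^sub>R mat 1 ||| \<epsilon>3 *\<^sub>R mat 1 ||| \<epsilon>4 *\<^sub>R mat 1))) ?v \<le> 0"
      unfolding quad_form_add .
    ultimately show ?thesis by simp
  qed
  define D where "D x t = A *v x t + (1 / h) *\<^sub>R (K *v integral {t - h..t} x)" for x t
  have "ereal (norm (x t)) \<le> ereal (\<gamma> * exp (- \<alpha> * t)) * norm_W h \<phi>"
    if \<phi>: "\<phi> differentiable_on {- h..0}" and sol: "delay_solution h D \<phi> x" and t: "t > 0" for \<phi> x t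
  proof (cases "norm_W h \<phi>")
    \<comment> \<open>The derivative of \<open>\<phi>\<close> may be unbounded; an infinite norm
      makes the estimate trivial, as its coefficient is positive.\<close>
    case PInf
    then show ?thesis using \<gamma>1 by simp
  next
    case MInf
    have "ereal (norm (\<phi> 0)) \<le> norm_W h \<phi>"
      unfolding norm_W_def norm_h_def using h by (intro max.coboundedI1 SUP_upper) auto
    then show ?thesis using MInf by simp
  next
    case (real M)
    have x\<phi>: "x s = \<phi> s" if "- h \<le> s" "s \<le> 0" for s
      using sol that by (simp add: delay_solution_def)
    have x: "(x has_vector_derivative D x t) (at t within {0..})" if "t \<ge> 0" for t
      using sol that by (simp add: delay_solution_def)
    have hist: "norm (x s) \<le> M" if "- h \<le> s" "s \<le> 0" for s
    proof -
      have "ereal (norm (\<phi> s)) \<le> norm_W h \<phi>"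
        unfolding norm_W_def norm_h_def using that by (intro max.coboundedI1 SUP_upper) auto
      then show ?thesis using real x\<phi> [OF that] by simp
    qed
    have M: "M \<ge> 0" using hist [of 0] h norm_ge_zero [of "x 0"] by linarith
    have "continuous_on {- h..0} x"
      using differentiable_imp_continuous_on [OF \<phi>] x\<phi>
      by (subst continuous_on_cong [OF refl, of _ _ \<phi>]) auto
    then have "continuous_on ({- h..0} \<union> {0..}) x"
      using continuous_on_Ici_of_derivative [OF x] by (intro continuous_on_closed_Un) auto
    moreover have "{- h..0} \<union> {0..} = {- h..}" using h by auto
    ultimately have contx: "continuous_on {- h..} x" by simp
    \<comment> \<open>Starting the antiderivative at \<open>- h\<close> turns the integral over
      every delay window into an increment of \<open>Z\<close>.\<close>
    then obtain Z where Z: "\<And>t. t \<ge> - h \<Longrightarrow> (Z has_vector_derivative x t) (at t within {- h..})"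
      using antiderivative_Ici by blast
    have int: "(x has_integral (Z t - Z (t - h))) {t - h..t}" if "t \<ge> 0" for t
      using h that
      by (intro fundamental_theorem_of_calculus) (auto intro!: has_vector_derivative_within_subset [OF Z])
    have Dx: "D x t = A *v x t + (1 / h) *\<^sub>R (K *v (Z t - Z (t - h)))" if "t \<ge> 0" for t
      using int [OF that] by (simp add: D_def integral_unique)
    have contZ: "continuous_on {- h..} Z" using Z by (rule continuous_on_Ici_of_derivative)
    have "continuous_on {0..} (\<lambda>t. A *v x t + (1 / h) *\<^sub>R (K *v (Z t - Z (t - h))))"
    proof (intro continuous_intros bounded_linear.continuous_on [of "(*v) A"]
        bounded_linear.continuous_on [of "(*v) K"])
      show "continuous_on {0..} x" "continuous_on {0..} Z"
        using contx contZ h by (auto elim!: continuous_on_subset)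
      show "continuous_on {0..} (\<lambda>t. Z (t - h))"
        by (rule continuous_on_compose2 [OF contZ]) (auto intro!: continuous_intros)
    qed simp_all
    then have contD: "continuous_on {0..} (D x)"
      by (subst continuous_on_cong [OF refl Dx]) auto
    have Dle: "norm (D x t) \<le> c * N"
      if t: "0 \<le> t" and N: "\<And>s. t - h \<le> s \<Longrightarrow> s \<le> t \<Longrightarrow> norm (x s) \<le> N" for t N
    proof -
      have N0: "N \<ge> 0" using N [of t] h norm_ge_zero [of "x t"] by linarith
      have "norm (Z t - Z (t - h)) \<le> N * h"
        using has_integral_bound [OF N0, of x _ "t - h" t] int [OF t] N h by auto
      then have "norm (K *v (Z t - Z (t - h))) \<le> (N * h) * k"
        using k(2) [of "Z t - Z (t - h)"] k(1) mult_right_mono [of _ "N * h" k]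
        by (meson less_imp_le order_trans)
      then have "norm ((1 / h) *\<^sub>R (K *v (Z t - Z (t - h)))) \<le> N * k"
        using h by (simp add: field_simps)
      moreover have "norm (A *v x t) \<le> N * a"
        using a(2) [of "x t"] mult_right_mono [OF N [of t] less_imp_le [OF a(1)]] h by simp
      ultimately show ?thesis
        unfolding Dx [OF t] c_def
        using norm_triangle_ineq [of "A *v x t" "(1 / h) *\<^sub>R (K *v (Z t - Z (t - h)))"]
        by (simp add: algebra_simps)
    qed
    \<comment> \<open>The range reaches back to \<open>- h\<close> because \<open>D x t\<close> with
      \<open>t\<close> in \<open>[0, h]\<close> also involves the history.\<close>
    have growth: "norm (x t) \<le> M * exp (c * h)" if "- h \<le> t" "t \<le> h" for t
    proof (cases "t \<le> 0")
      case True
      then have "norm (x t) \<le> M" using hist that by simp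
      also have "\<dots> \<le> M * exp (c * h)" using M c h by (simp add: mult_le_cancel_left1)
      finally show ?thesis .
    next
      case False
      then have "norm (x t) \<le> M * exp (c * t)"
        by (intro delay_growth_bound [where x' = "D x"] h less_imp_le [OF c] hist x Dle)
          (use that in simp_all)
      also have "\<dots> \<le> M * exp (c * h)"
        using M c that by (intro mult_left_mono) (auto intro: mult_left_mono)
      finally show ?thesis .
    qed
    have "norm (x t) \<le> \<gamma> * exp (- \<alpha> * t) * M"
    proof (cases "t \<le> h")
      case True
      \<comment> \<open>Up to time \<open>h\<close> the weight \<open>exp (- \<alpha> * t)\<close>
        is at least \<open>exp (- \<alpha> * h)\<close>, so the factor
        \<open>exp (\<alpha> * h)\<close> in \<open>\<gamma>\<close> compensates for it.\<close>
      have "1 \<le> exp (\<alpha> * h) * exp (- \<alpha> * t)"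
        using True \<alpha> by (simp add: exp_add [symmetric] mult_left_mono)
      then have "M * exp (c * h) * 1 \<le> M * exp (c * h) * (exp (\<alpha> * h) * exp (- \<alpha> * t))"
        using M by (intro mult_left_mono) auto
      moreover have "norm (x t) \<le> M * exp (c * h)" using growth True t h by simp
      moreover have "(exp (c * h) * exp (\<alpha> * h)) * (exp (- \<alpha> * t) * M) \<le> \<gamma> * (exp (- \<alpha> * t) * M)"
        using M b C L by (intro mult_right_mono) (auto simp: \<gamma>_def)
      ultimately show ?thesis by (simp add: mult_ac)
    next
      case False
      have lin: "((\<lambda>t. X' *v f t) has_vector_derivative X' *v f') F"
        if "(f has_vector_derivative f') F" for f f' F
        using that by (rule bounded_linear.has_vector_derivative [rotated]) simp
      \<comment> \<open>The decay estimate is applied to the transformed solution, with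
        \<open>L * M\<close> as its bound on \<open>[0, h]\<close>; multiplying by \<open>X\<close>
        afterwards costs the factor \<open>b\<close>.\<close>
      have "norm (X' *v x t) \<le> C * exp (- \<alpha> * t) * (L * M)"
      proof (rule decay [where d = "\<lambda>t. X' *v D x t" and Y = "\<lambda>t. X' *v Z t"],
          unfold admissible_trajectory_def, intro conjI allI impI)
        show "((\<lambda>t. X' *v x t) has_vector_derivative X' *v D x t) (at t within {0..})" if "t \<ge> 0" for t
          using x [OF that] by (rule lin)
        show "((\<lambda>t. X' *v Z t) has_vector_derivative X' *v x t) (at t within {0..})" if "t \<ge> 0" for t
          by (rule lin, rule has_vector_derivative_within_subset [OF Z]) (use h that in auto)
        show "continuous_on {0..} (\<lambda>t. X' *v D x t)"
          by (intro bounded_linear.continuous_on [of "(*v) X'"] contD) simp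
        show "\<forall>t\<in>{0..h}. norm (X' *v x t) \<le> L * M \<and> norm (X' *v D x t) \<le> L * M"
        proof (intro ballI conjI)
          fix t assume that: "t \<in> {0..h}"
          let ?N = "M * exp (c * h)"
          have N0: "?N \<ge> 0" using M by simp
          have "norm (x t) \<le> (1 + c) * ?N"
            using growth [of t] that h mult_nonneg_nonneg [OF less_imp_le [OF c] N0]
            by (simp add: distrib_right)
          then have "norm (x t) * b' \<le> (1 + c) * ?N * b'"
            using b' by (intro mult_right_mono) auto
          then show "norm (X' *v x t) \<le> L * M"
            using b'(2) [of "x t"] by (simp add: L_def mult_ac)
          have "norm (D x t) \<le> c * ?N"
            by (rule Dle) (use growth that in auto)
          then have "norm (D x t) \<le> (1 + c) * ?N" using N0 by (simp add: distrib_right)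
          then have "norm (D x t) * b' \<le> (1 + c) * ?N * b'"
            using b' by (intro mult_right_mono) auto
          then show "norm (X' *v D x t) \<le> L * M"
            using b'(2) [of "D x t"] by (simp add: L_def mult_ac)
        qed
        show "h \<le> t" using False by simp
        show "quad_form (Phi P R S \<alpha> h) (vjoin (X' *v x t) (vjoin (X' *v x (t - h))
            (vjoin (X' *v D x t) ((1 / h) *\<^sub>R (X' *v Z t - X' *v Z (t - h)))))) \<le> 0" if "h < t" for t
        proof (rule lmi)
          \<comment> \<open>As \<open>K\<close> factors through \<open>X'\<close>, the delay
            equation for \<open>x\<close> becomes the premise of \<open>lmi\<close> for the
            transformed data.\<close>
          have "K *v v = B *v (Kbar *v (X' *v v))" for v
            by (simp add: K_def X'_def matrix_vector_mul_assoc)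
          then show "A *v (X *v (X' *v x t)) - X *v (X' *v D x t)
              + B *v (Kbar *v ((1 / h) *\<^sub>R (X' *v Z t - X' *v Z (t - h)))) = 0"
            using that h
            by (simp add: XX' Dx matrix_vector_mult_scaleR flip: matrix_vector_mult_diff_distrib)
        qed
      qed
      then have "norm (X' *v x t) * b \<le> C * exp (- \<alpha> * t) * (L * M) * b"
        using b by (intro mult_right_mono) auto
      then have "norm (x t) \<le> (b * C * L) * (exp (- \<alpha> * t) * M)"
        using b(2) [of "X' *v x t"] by (simp add: XX' mult_ac)
      also have "\<dots> \<le> \<gamma> * (exp (- \<alpha> * t) * M)"
        using M by (intro mult_right_mono) (auto simp: \<gamma>_def)
      finally show ?thesis by (simp add: mult_ac)
    qed
    then show ?thesis using real by simp
  qed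
  then have "alpha_stable \<alpha> h D"
    unfolding alpha_stable_def using \<gamma>1 by blast
  then show ?thesis unfolding D_def [abs_def] K_def .
qed

end
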